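(* Let $S$ be an arborescent poset with consistent anti-linearization $v:S\hookrightarrow[1,m]$ and let $\lambda$ be a partition. The restriction of the Bruhat partial order of $\mathbb S_m\lambda$ to the subset $\mathbb D_S^v(\lambda)\subset\mathbb S_m\lambda$ of $S$-dominant compositions is generated by the relations $a\prec(ij)a$, where $a\in\mathbb D^v_S(\lambda)$ and $(ij)$ is a minimal $S$-disorder for $a$.
   Context: An arborescent poset with consistent anti-linearization is a finite poset $(S,\preceq)$ with an injective order-reversing map $v:S\to[1,m]=\{1,\dots,m\}$ ($s\succ t\Rightarrow v(s)<v(t)$) such that for every $s\in S$ the set $S_{\succeq s}=\{t:t\succeq s\}$ equals $v^{-1}([a_s,b_s])$ for some $a_s\le b_s\le m$. A composition $d\in\mathbb Z_{\ge0}^m$ is $S$-dominant if $d_l=0$ for $l\notin v(S)$ and $d_{v(s)}\ge d_{v(t)}$ whenever $s\succ t$. $\mathbb S_m\lambda$ is the set of rearrangements of $\lambda$ padded by zeros to length $m$; $\mathbb D_S^v(\lambda)$ is the set of $S$-dominant elements of $\mathbb S_m\lambda$. The Bruhat order on $\mathbb S_m\lambda$ is the reflexive transitive closure of $a\prec(ij)a$ whenever $i<j$ and $a_i>a_j$, where $(ij)a$ exchanges the $i$-th and $j$-th entries (strong Bruhat order on $\mathbb S_m/\mathrm{Stab}(\lambda)$). A pair $i<j$ in $v(S)$ is a minimal $S$-disorder for an $S$-dominant $d$ if: $v^{-1}(i)$ and $v^{-1}(j)$ are incomparable in $S$; $d_i>d_j$; and for all $l\in v(S)$ with $i<l<j$: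 $v^{-1}(l)\prec v^{-1}(i)$ implies $d_l\le d_j$; $v^{-1}(l)\succ v^{-1}(j)$ implies $d_l\ge d_i$; and $v^{-1}(l)$ incomparable with both $v^{-1}(i)$ and $v^{-1}(j)$ implies $d_l\notin[d_j,d_i]$. *)

theory Defs
  imports "HOL-Library.Multiset" "HOL-Combinatorics.Transposition"
begin

text \<open>A poset is given by its carrier \<open>S\<close> and the set \<open>r\<close> of pairs \<open>(s, t)\<close> with
  \<open>s \<preceq> t\<close>; hence \<open>above r s\<close> is \<open>S\<^sub>\<succeq>\<^sub>s\<close>, and \<open>s \<prec> t\<close> is \<open>(s, t) \<in> r - Id\<close>.\<close>

definition arborescent_poset :: "nat \<Rightarrow> 's set \<Rightarrow> 's rel \<Rightarrow> ('s \<Rightarrow> nat) \<Rightarrow> bool" where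
  "arborescent_poset m S r v \<longleftrightarrow>
     finite S \<and> partial_order_on S r \<and>
     inj_on v S \<and> v ` S \<subseteq> {1..m} \<and>
     (\<forall>s\<in>S. \<forall>t\<in>S. (t, s) \<in> r - Id \<longrightarrow> v s < v t) \<and>
     (\<forall>s\<in>S. \<exists>a b. 1 \<le> a \<and> a \<le> b \<and> b \<le> m \<and> above r s = {t \<in> S. v t \<in> {a..b}})"

definition incomparable :: "'s rel \<Rightarrow> 's \<Rightarrow> 's \<Rightarrow> bool" where
  "incomparable r s t \<longleftrightarrow> (s, t) \<notin> r \<and> (t, s) \<notin> r"

definition is_partition :: "nat list \<Rightarrow> bool" where
  "is_partition lam \<longleftrightarrow> sorted_wrt (\<ge>) lam \<and> 0 \<notin> set lam"

text \<open>A composition of length \<open>m\<close> is a function on \<open>{1..m}\<close>, extended by \<open>0\<close> to all of \<open>nat\<close> so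
  that equality of functions is equality of compositions.\<close>

definition compositions :: "nat \<Rightarrow> (nat \<Rightarrow> nat) set" where
  "compositions m = {d. \<forall>l. l \<notin> {1..m} \<longrightarrow> d l = 0}"

text \<open>If \<open>lam\<close> has more than \<open>m\<close> parts, it cannot be padded to length \<open>m\<close>, and the set
  below is empty.\<close>

definition rearrangements :: "nat \<Rightarrow> nat list \<Rightarrow> (nat \<Rightarrow> nat) set" where
  "rearrangements m lam =
     {d \<in> compositions m. mset (map d [1..<Suc m]) = mset (lam @ replicate (m - length lam) 0)}"

definition swap_entries :: "nat \<Rightarrow> nat \<Rightarrow> (nat \<Rightarrow> nat) \<Rightarrow> (nat \<Rightarrow> nat)" where
  "swap_entries i j d = d \<circ> Transposition.transpose i j"

text \<open>The reflexive transitive closure of \<open>R\<close> on the set \<open>A\<close>; unlike \<open>R\<^sup>*\<close>, it relates no points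
  outside \<open>A\<close> when \<open>R \<subseteq> A \<times> A\<close>.\<close>

definition generated_order :: "'a set \<Rightarrow> 'a rel \<Rightarrow> 'a rel" where
  "generated_order A R = Id_on A \<union> R\<^sup>+"

definition bruhat_order :: "nat \<Rightarrow> nat list \<Rightarrow> (nat \<Rightarrow> nat) rel" where
  "bruhat_order m lam = generated_order (rearrangements m lam)
     {(a, swap_entries i j a) | a i j.
        a \<in> rearrangements m lam \<and> i \<in> {1..m} \<and> j \<in> {1..m} \<and> i < j \<and> a i > a j}"

definition S_dominant :: "nat \<Rightarrow> 's set \<Rightarrow> 's rel \<Rightarrow> ('s \<Rightarrow> nat) \<Rightarrow> (nat \<Rightarrow> nat) \<Rightarrow> bool" where
  "S_dominant m S r v d \<longleftrightarrow>
     d \<in> compositions m \<and>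
     (\<forall>l\<in>{1..m} - v ` S. d l = 0) \<and>
     (\<forall>s\<in>S. \<forall>t\<in>S. (t, s) \<in> r - Id \<longrightarrow> d (v s) \<ge> d (v t))"

definition dominant_rearrangements ::
    "nat \<Rightarrow> 's set \<Rightarrow> 's rel \<Rightarrow> ('s \<Rightarrow> nat) \<Rightarrow> nat list \<Rightarrow> (nat \<Rightarrow> nat) set" where
  "dominant_rearrangements m S r v lam = {d \<in> rearrangements m lam. S_dominant m S r v d}"

definition minimal_disorder ::
    "'s set \<Rightarrow> 's rel \<Rightarrow> ('s \<Rightarrow> nat) \<Rightarrow> (nat \<Rightarrow> nat) \<Rightarrow> nat \<Rightarrow> nat \<Rightarrow> bool" where
  "minimal_disorder S r v d i j \<longleftrightarrow>
     i \<in> v ` S \<and> j \<in> v ` S \<and> i < j \<and>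
     incomparable r (inv_into S v i) (inv_into S v j) \<and>
     d i > d j \<and>
     (\<forall>l\<in>v ` S. i < l \<and> l < j \<longrightarrow>
        ((inv_into S v l, inv_into S v i) \<in> r - Id \<longrightarrow> d l \<le> d j) \<and>
        ((inv_into S v j, inv_into S v l) \<in> r - Id \<longrightarrow> d l \<ge> d i) \<and>
        (incomparable r (inv_into S v l) (inv_into S v i) \<and>
         incomparable r (inv_into S v l) (inv_into S v j) \<longrightarrow> d l \<notin> {d j..d i}))"

end

theory Submission
  imports Defs
begin

text \<open>For a poset with a consistent anti-linearization, the positions \<open>v ` S\<close> form a forest
  numbered in postorder, and dominance says that entries weakly decrease towards the roots.
  Let \<open>N d k x\<close> be the number of positions \<open>l \<le> k\<close> with \<open>d l \<ge> x\<close>; going up in the Bruhat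
  order can only decrease \<open>N\<close>. Given dominant \<open>a \<noteq> c\<close> with \<open>N c \<le> N a\<close>, it therefore suffices to
  find a minimal disorder \<open>(i, j)\<close> of \<open>a\<close> whose exchange keeps \<open>N\<close> above \<open>N c\<close>, that is, with
  \<open>N c < N a\<close> on the rectangle \<open>[i, j) \<times> (a j, a i]\<close>. Among all incomparable pairs with this
  property, one with \<open>j - i\<close> least is a minimal disorder. To see that such pairs exist, start from
  the first position where \<open>a\<close> and \<open>c\<close> differ and compare \<open>a\<close> and \<open>c\<close> along the path from it to
  the root.\<close>

section \<open>Counting functions and their change under exchanges\<close>

definition count_ge :: "nat set \<Rightarrow> (nat \<Rightarrow> nat) \<Rightarrow> nat \<Rightarrow> nat \<Rightarrow> nat" where
  "count_ge P d k x = card {l \<in> P. l \<le> k \<and> x \<le> d l}"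

lemma swap_entries_apply:
  "swap_entries i j d l = (if l = i then d j else if l = j then d i else d l)"
  by (simp add: swap_entries_def Transposition.transpose_def)

text \<open>The larger entry starts to count at \<open>j\<close> instead of \<open>i\<close>, the
  smaller one at \<open>i\<close> instead of \<open>j\<close>; thresholds reached by both or by
  neither do not notice. The additive form avoids truncated subtraction.\<close>

lemma count_ge_swap_entries:
  assumes "finite P" "i \<in> P" "j \<in> P" "i < j" "d j < d i"
  shows "count_ge P (swap_entries i j d) k x
    + of_bool (i \<le> k \<and> k < j \<and> d j < x \<and> x \<le> d i) = count_ge P d k x"
proof -
  define Q where "Q = {l \<in> P. l \<le> k \<and> l \<noteq> i \<and> l \<noteq> j}"
  have fin: "finite Q" using assms unfolding Q_def by auto
  \<comment> \<open>Stated for every \<open>e\<close>, so that it applies both to \<open>d\<close>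
    and to its exchange, which agree on \<open>Q\<close>.\<close>
  have expand: "count_ge P e k x = card {l \<in> Q. x \<le> e l}
      + of_bool (i \<le> k \<and> x \<le> e i) + of_bool (j \<le> k \<and> x \<le> e j)" for e :: "nat \<Rightarrow> nat"
  proof -
    have *: "{l \<in> P. l \<le> k \<and> x \<le> e l} = {l \<in> Q. x \<le> e l} \<union>
        ({l \<in> {i}. l \<le> k \<and> x \<le> e l} \<union> {l \<in> {j}. l \<le> k \<and> x \<le> e l})"
      using assms unfolding Q_def by auto
    have c1: "card {l \<in> {t}. l \<le> k \<and> x \<le> e l} = of_bool (t \<le> k \<and> x \<le> e t)" for t
    proof (cases "t \<le> k \<and> x \<le> e t")
      case True
      then have "{l \<in> {t}. l \<le> k \<and> x \<le> e l} = {t}" by auto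
      with True show ?thesis by simp
    next
      case False
      then have "{l \<in> {t}. l \<le> k \<and> x \<le> e l} = {}" by auto
      with False show ?thesis by (simp only: card.empty) simp
    qed
    have "card {l \<in> P. l \<le> k \<and> x \<le> e l} = card {l \<in> Q. x \<le> e l}
        + card ({l \<in> {i}. l \<le> k \<and> x \<le> e l} \<union> {l \<in> {j}. l \<le> k \<and> x \<le> e l})"
      unfolding * by (rule card_Un_disjoint) (use fin in \<open>auto simp: Q_def\<close>)
    also have "card ({l \<in> {i}. l \<le> k \<and> x \<le> e l} \<union> {l \<in> {j}. l \<le> k \<and> x \<le> e l})
        = card {l \<in> {i}. l \<le> k \<and> x \<le> e l} + card {l \<in> {j}. l \<le> k \<and> x \<le> e l}"
      by (rule card_Un_disjoint) (use assms in auto)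
    finally show ?thesis unfolding count_ge_def c1 by simp
  qed
  have "{l \<in> Q. x \<le> swap_entries i j d l} = {l \<in> Q. x \<le> d l}"
    unfolding Q_def by (auto simp: swap_entries_apply)
  moreover have "swap_entries i j d i = d j" "swap_entries i j d j = d i"
    by (auto simp: swap_entries_apply)
  ultimately show ?thesis
    unfolding expand[of d] expand[of "swap_entries i j d"] using assms(4,5) by auto
qed

text \<open>This serves to turn a weak inequality at a low threshold \<open>y\<close> into a strict
  one at \<open>x\<close>, by comparing how many values lie in between.\<close>

lemma count_ge_split:
  assumes "finite P" "y \<le> x"
  shows "count_ge P d k y = count_ge P d k x + card {l \<in> P. l \<le> k \<and> y \<le> d l \<and> d l < x}"
proof -
  have "{l \<in> P. l \<le> k \<and> y \<le> d l}
      = {l \<in> P. l \<le> k \<and> x \<le> d l} \<union> {l \<in> P. l \<le> k \<and> y \<le> d l \<and> d l < x}"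
    using assms by auto
  then show ?thesis
    unfolding count_ge_def using assms by (simp add: card_Un_disjoint disjoint_iff)
qed

section \<open>Forests numbered in postorder\<close>

text \<open>\<open>anc i l\<close> means that \<open>l\<close> is a proper ancestor of \<open>i\<close>.\<close>

locale postorder_forest =
  fixes P :: "nat set" and anc :: "nat \<Rightarrow> nat \<Rightarrow> bool"
  assumes finite_P: "finite P"
    and anc_in: "anc i l \<Longrightarrow> i \<in> P \<and> l \<in> P"
    and anc_less: "anc i l \<Longrightarrow> i < l"
    and anc_trans: "anc i l \<Longrightarrow> anc l k \<Longrightarrow> anc i k"
    and anc_interval: "anc i l \<Longrightarrow> j \<in> P \<Longrightarrow> i < j \<Longrightarrow> j < l \<Longrightarrow> anc j l"
begin

definition decreasing :: "(nat \<Rightarrow> nat) \<Rightarrow> bool" where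
  "decreasing d \<longleftrightarrow> (\<forall>i l. anc i l \<longrightarrow> d l \<le> d i)"

text \<open>The counterpart of \<open>minimal_disorder\<close> on positions: ancestors come later,
  so for \<open>i < j\<close> incomparability amounts to \<open>\<not> anc i j\<close>.\<close>

definition min_disorder :: "(nat \<Rightarrow> nat) \<Rightarrow> nat \<Rightarrow> nat \<Rightarrow> bool" where
  "min_disorder d i j \<longleftrightarrow> i \<in> P \<and> j \<in> P \<and> i < j \<and> \<not> anc i j \<and> d j < d i \<and>
     (\<forall>l\<in>P. i < l \<and> l < j \<longrightarrow> (anc i l \<longrightarrow> d l \<le> d j) \<and> (anc l j \<longrightarrow> d i \<le> d l) \<and>
        (\<not> anc i l \<and> \<not> anc l j \<longrightarrow> d l \<notin> {d j..d i}))"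

lemma decreasingD: "decreasing d \<Longrightarrow> anc i l \<Longrightarrow> d l \<le> d i"
  unfolding decreasing_def by blast

text \<open>Lowering the entry at \<open>i\<close> endangers only ancestors of \<open>i\<close>:
  those before \<open>j\<close> are controlled by minimality, those after \<open>j\<close> are
  ancestors of \<open>j\<close> too. Raising the entry at \<open>j\<close> endangers only
  descendants of \<open>j\<close>: those after \<open>i\<close> are controlled by minimality, and
  one before \<open>i\<close> would force \<open>anc i j\<close>.\<close>

lemma decreasing_swap_entries:
  assumes "decreasing d" "min_disorder d i j"
  shows "decreasing (swap_entries i j d)"
  unfolding decreasing_def
proof (intro allI impI)
  fix k l assume kl: "anc k l"
  have md: "i \<in> P" "j \<in> P" "i < j" "\<not> anc i j" "d j < d i"
    and up: "\<And>l. l \<in> P \<Longrightarrow> i < l \<Longrightarrow> l < j \<Longrightarrow> anc i l \<Longrightarrow> d l \<le> d j"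
    and down: "\<And>l. l \<in> P \<Longrightarrow> i < l \<Longrightarrow> l < j \<Longrightarrow> anc l j \<Longrightarrow> d i \<le> d l"
    using assms(2) unfolding min_disorder_def by auto
  note klP = anc_in[OF kl] anc_less[OF kl] decreasingD[OF assms(1) kl]
  have i_up: "d l \<le> d j" if "k = i" "l \<noteq> j"
  proof (cases "l < j")
    case True
    then show ?thesis using up kl klP that by auto
  next
    case False
    then have "anc j l" using anc_interval[of i l j] kl md that by auto
    then show ?thesis using decreasingD[OF assms(1)] by blast
  qed
  have j_down: "d i \<le> d k" if "l = j" "k \<noteq> i"
  proof (cases "i < k")
    case True
    then show ?thesis using down kl klP that by auto
  next
    case False
    then have "anc i j" using anc_interval[of k j i] kl md that by auto
    then show ?thesis using md by blast
  qed
  show "swap_entries i j d l \<le> swap_entries i j d k"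
    using i_up j_down klP md kl by (auto simp: swap_entries_apply)
qed

text \<open>A position \<open>l\<close> violating minimality yields a shorter incomparable pair,
  \<open>(l, j)\<close> or \<open>(i, l)\<close>. Its rectangle lies inside the old one, so the
  strict inequalities are inherited.\<close>

lemma min_disorder_from_disorder:
  assumes "decreasing a"
    and "i \<in> P" "j \<in> P" "i < j" "\<not> anc i j" "a j < a i"
    and "\<And>k x. i \<le> k \<Longrightarrow> k < j \<Longrightarrow> a j < x \<Longrightarrow> x \<le> a i \<Longrightarrow> count_ge P c k x < count_ge P a k x"
  shows "\<exists>i j. min_disorder a i j \<and> (\<forall>k x. i \<le> k \<and> k < j \<and> a j < x \<and> x \<le> a i
    \<longrightarrow> count_ge P c k x < count_ge P a k x)"
  using assms(2-)
proof (induction "j - i" arbitrary: i j rule: less_induct)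
  case less
  show ?case
  proof (cases "min_disorder a i j")
    case True
    then show ?thesis using less.prems by blast
  next
    case False
    then obtain l where l: "l \<in> P" "i < l" "l < j" and
      bad: "anc i l \<and> a j < a l \<or> anc l j \<and> a l < a i
        \<or> \<not> anc i l \<and> \<not> anc l j \<and> a j \<le> a l \<and> a l \<le> a i"
      using less.prems unfolding min_disorder_def by (auto simp: not_le)
    have left: ?thesis if "\<not> anc l j" "a j < a l" "a l \<le> a i"
      by (rule less.hyps[of j l]) (use l less.prems that in auto)
    have right: ?thesis if "\<not> anc i l" "a j \<le> a l" "a l < a i"
      by (rule less.hyps[of l i]) (use l less.prems that in auto)
    \<comment> \<open>If \<open>l\<close> is incomparable to both ends, a tie decides the side:
      \<open>(i, l)\<close> is no disorder when \<open>a l = a i\<close>, but then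
      \<open>(l, j)\<close> is one.\<close>
    from bad consider "anc i l" "a j < a l" | "anc l j" "a l < a i"
      | "\<not> anc i l" "\<not> anc l j" "a j \<le> a l" "a l < a i"
      | "\<not> anc i l" "\<not> anc l j" "a j \<le> a l" "a l = a i"
      by force
    then show ?thesis
    proof cases
      case 1
      then show ?thesis
        using left anc_trans[of i l j] less.prems decreasingD[OF assms(1), of i l] by auto
    next
      case 2
      then show ?thesis
        using right anc_trans[of i l j] less.prems decreasingD[OF assms(1), of l j] by auto
    next
      case 3
      then show ?thesis using right by auto
    next
      case 4
      then show ?thesis using left less.prems by auto
    qed
  qed
qed

text \<open>The right end \<open>j\<close> is the first position after \<open>i\<close> off the path
  from \<open>i\<close> to the root with an entry in \<open>{c q..<a i}\<close>. The left end is not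
  \<open>i\<close> in general, but the last path position \<open>s \<le> q\<close> before
  \<open>j\<close> with \<open>a j < a s\<close>.\<close>

lemma ex_disorder:
  assumes a: "decreasing a" and c: "decreasing c"
    and dom: "\<And>k x. count_ge P c k x \<le> count_ge P a k x"
    and total: "\<And>x. count_ge P a m x = count_ge P c m x"
    and bound: "\<And>l. l \<in> P \<Longrightarrow> l \<le> m"
    and ne: "\<exists>l\<in>P. a l \<noteq> c l"
  shows "\<exists>i j. i \<in> P \<and> j \<in> P \<and> i < j \<and> \<not> anc i j \<and> a j < a i \<and>
    (\<forall>k x. i \<le> k \<and> k < j \<and> a j < x \<and> x \<le> a i \<longrightarrow> count_ge P c k x < count_ge P a k x)"
proof -
  define i where "i = (LEAST l. l \<in> P \<and> a l \<noteq> c l)"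
  have i: "i \<in> P" "a i \<noteq> c i"
    using LeastI_ex[of "\<lambda>l. l \<in> P \<and> a l \<noteq> c l"] ne unfolding i_def by auto
  have before: "a l = c l" if "l \<in> P" "l < i" for l
    using not_less_Least[of l "\<lambda>l. l \<in> P \<and> a l \<noteq> c l"] that unfolding i_def by auto
  \<comment> \<open>Otherwise \<open>c\<close> would have one more entry \<open>\<ge> c i\<close>
    than \<open>a\<close> among the positions up to \<open>i\<close>.\<close>
  have ci: "c i < a i"
  proof (rule ccontr)
    assume "\<not> c i < a i"
    then have "a i < c i" using i by auto
    have "{l \<in> P. l \<le> i \<and> c i \<le> a l} \<subset> {l \<in> P. l \<le> i \<and> c i \<le> c l}"
    proof
      show "{l \<in> P. l \<le> i \<and> c i \<le> a l} \<subseteq> {l \<in> P. l \<le> i \<and> c i \<le> c l}"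
        using before \<open>a i < c i\<close> by (auto simp: le_less)
      show "{l \<in> P. l \<le> i \<and> c i \<le> a l} \<noteq> {l \<in> P. l \<le> i \<and> c i \<le> c l}"
      proof -
        have "i \<in> {l \<in> P. l \<le> i \<and> c i \<le> c l}" "i \<notin> {l \<in> P. l \<le> i \<and> c i \<le> a l}"
          using i \<open>a i < c i\<close> by auto
        then show ?thesis by blast
      qed
    qed
    then have "count_ge P a i (c i) < count_ge P c i (c i)"
      unfolding count_ge_def by (intro psubset_card_mono) (use finite_P in auto)
    then show False using dom[of i "c i"] by simp
  qed
  define A where "A = {l \<in> P. l = i \<or> anc i l}"
  have A_P: "A \<subseteq> P" and finA: "finite A" and iA: "i \<in> A"
    using finite_P i unfolding A_def by auto
  \<comment> \<open>By \<open>anc_interval\<close>, whatever lies between \<open>i\<close> and an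
    ancestor of \<open>i\<close> is below that ancestor; hence the path is a chain ordered by
    position.\<close>
  have A_anc: "anc k l" if "k \<in> A" "l \<in> A" "k < l" for k l
    using that anc_interval[of i l k] anc_less unfolding A_def by fastforce
  have A_ge: "i \<le> l" if "l \<in> A" for l
    using that anc_less unfolding A_def by fastforce
  have A_up: "l \<in> A" if "k \<in> A" "anc k l" for k l
    using that anc_trans anc_in unfolding A_def by blast
  have monoA: "a l \<le> a k" "c l \<le> c k" if "k \<in> A" "l \<in> A" "k \<le> l" for k l
    using that A_anc[of k l] decreasingD[OF a] decreasingD[OF c] by (auto simp: le_less)
  \<comment> \<open>For the first such \<open>q\<close>, the intervals \<open>{c t<..a t}\<close> with \<open>t \<le> q\<close> on the path from \<open>i\<close> cover
    \<open>{c q<..a i}\<close> without gaps, and beyond \<open>q\<close> the path does not contribute to values \<open>\<ge> c q\<close>.\<close>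
  define stop where "stop q \<longleftrightarrow> q \<in> A \<and> (\<forall>l\<in>A. q < l \<longrightarrow> a l < c q)" for q
  \<comment> \<open>At the end of the path the condition on later positions is vacuous, so a least
    \<open>q\<close> exists.\<close>
  have "Max A \<in> A" using finA iA by (intro Max_in) auto
  then have "stop (Max A)"
    using Max_ge[OF finA] unfolding stop_def by (auto simp: not_less[symmetric])
  define q where "q = (LEAST q. stop q)"
  have "stop q" unfolding q_def by (rule LeastI, fact)
  then have qA: "q \<in> A" and after: "\<And>l. l \<in> A \<Longrightarrow> q < l \<Longrightarrow> a l < c q"
    unfolding stop_def by auto
  have overlap: "\<exists>l\<in>A. t < l \<and> c t \<le> a l" if "t \<in> A" "t < q" for t
    using not_less_Least[of t stop] that unfolding q_def stop_def by (auto simp: not_less)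
  \<comment> \<open>For \<open>t < q\<close>, the overlap gives a later \<open>l\<close> with
    \<open>c t \<le> a l \<le> a t\<close>. For \<open>t = q \<noteq> i\<close>, let
    \<open>p\<close> be the path position just before \<open>q\<close>: its overlap is with some
    \<open>l \<ge> q\<close>, so \<open>c q \<le> c p \<le> a l \<le> a q\<close>.\<close>
  have c_le_a: "c t \<le> a t" if t: "t \<in> A" "t \<le> q" for t
  proof (cases "t < q")
    case True
    then obtain l where "l \<in> A" "t < l" "c t \<le> a l" using overlap t by blast
    then show ?thesis using monoA(1)[of t l] t by simp
  next
    case False
    then have tq: "t = q" using t by simp
    show ?thesis
    proof (cases "q = i")
      case True
      then show ?thesis using ci tq by simp
    next
      case False
      define B where "B = {p \<in> A. p < q}"
      have "i \<in> B" "finite B" using A_ge[OF qA] False iA finA unfolding B_def by auto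
      define p where "p = Max B"
      have "p \<in> B" unfolding p_def using \<open>i \<in> B\<close> \<open>finite B\<close> by (intro Max_in) auto
      then have p: "p \<in> A" "p < q" unfolding B_def by auto
      then obtain l where l: "l \<in> A" "p < l" "c p \<le> a l" using overlap by blast
      have "l \<notin> B" using Max_ge[OF \<open>finite B\<close>, of l] l unfolding p_def[symmetric] by auto
      then have "\<not> l < q" using l unfolding B_def by auto
      then show ?thesis
        using monoA(1)[of q l] monoA(2)[of p q] l p qA tq by simp
    qed
  qed
  \<comment> \<open>Start from dominance at threshold \<open>c q\<close> and remove the entries with
    values in \<open>{c q..<x}\<close>. If \<open>a\<close> has no such entry off the path between
    \<open>i\<close> and \<open>k\<close>, each position removed for \<open>a\<close> is also
    removed for \<open>c\<close>, and \<open>s\<close> is removed for \<open>c\<close> only.\<close>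
  have strict: "count_ge P c k x < count_ge P a k x"
    if s: "s \<in> A" "s \<le> q" "s \<le> k" "c s < x" "x \<le> a s"
      and free: "\<And>l. l \<in> P \<Longrightarrow> i < l \<Longrightarrow> l \<le> k \<Longrightarrow> l \<notin> A \<Longrightarrow> c q \<le> a l \<Longrightarrow> a l < x \<Longrightarrow> False"
    for s k x
  proof -
    have qs: "c q \<le> c s" using monoA(2) s qA by blast
    let ?F = "\<lambda>d. {l \<in> P. l \<le> k \<and> c q \<le> d l \<and> d l < x}"
    have "?F a \<subset> ?F c"
    proof
      show "?F a \<subseteq> ?F c"
      proof
        fix l assume l: "l \<in> ?F a"
        show "l \<in> ?F c"
        proof (cases "l < i")
          case True
          then show ?thesis using l before by auto
        next
          case False
          then have "l \<in> A" using free[of l] l iA by (cases "l = i") auto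
          moreover have "l \<le> q" using after[of l] l \<open>l \<in> A\<close> by force
          ultimately show ?thesis using c_le_a[of l] monoA(2)[of l q] qA l by auto
        qed
      qed
      have "s \<in> ?F c" "s \<notin> ?F a" using s qs A_P by auto
      then show "?F a \<noteq> ?F c" by blast
    qed
    then have "card (?F a) < card (?F c)"
      by (intro psubset_card_mono) (use finite_P in auto)
    moreover have "c q \<le> x" using qs s by simp
    ultimately show ?thesis
      using count_ge_split[OF finite_P, of "c q" x a k] count_ge_split[OF finite_P, of "c q" x c k]
        dom[of k "c q"] by linarith
  qed
  define target where
    "target j \<longleftrightarrow> j \<in> P \<and> i < j \<and> j \<notin> A \<and> c q \<le> a j \<and> a j < a i" for j
  \<comment> \<open>Without a target, \<open>strict\<close> would apply with \<open>s = i\<close>,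
    \<open>k = m\<close> and \<open>x = a i\<close>, against the equality of the counts at
    \<open>m\<close>.\<close>
  have "\<exists>j. target j"
  proof (rule ccontr)
    assume "\<nexists>j. target j"
    then have "count_ge P c m (a i) < count_ge P a m (a i)"
      by (intro strict[of i]) (use iA A_ge[OF qA] bound[OF i(1)] ci in \<open>auto simp: target_def\<close>)
    then show False using total by simp
  qed
  define j where "j = (LEAST j. target j)"
  have "target j" unfolding j_def using \<open>\<exists>j. target j\<close> by (rule LeastI_ex)
  then have j: "j \<in> P" "i < j" "j \<notin> A" "c q \<le> a j" "a j < a i" unfolding target_def by auto
  have j_least: "\<not> target l" if "l < j" for l
    using that not_less_Least unfolding j_def by blast
  define C where "C = {s \<in> A. s < j \<and> s \<le> q \<and> a j < a s}"
  have C: "finite C" "i \<in> C" using finA iA j A_ge[OF qA] unfolding C_def by auto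
  define s where "s = Max C"
  have "s \<in> C" unfolding s_def using C by (intro Max_in) auto
  then have s: "s \<in> A" "s < j" "s \<le> q" "a j < a s" unfolding C_def by auto
  \<comment> \<open>This places \<open>{a j<..a s}\<close> inside \<open>{c s<..a s}\<close>, where
    \<open>strict\<close> applies. If it failed, the overlap after \<open>s\<close> would give a
    path position \<open>l \<le> q\<close> with \<open>a j < a l\<close>; maximality of
    \<open>s\<close> puts \<open>l\<close> beyond \<open>j\<close>, so \<open>l\<close> is an
    ancestor of \<open>j\<close> with a larger entry.\<close>
  have cs: "c s \<le> a j"
  proof (rule ccontr)
    assume "\<not> c s \<le> a j"
    then have "s < q" using j s by (auto simp: le_less)
    then obtain l where l: "l \<in> A" "s < l" "c s \<le> a l" using overlap s by blast
    have "a j < a l" using l \<open>\<not> c s \<le> a j\<close> by simp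
    have "l \<le> q" using after[of l] l j \<open>a j < a l\<close> by force
    have "l \<notin> C" using Max_ge[OF C(1), of l] l unfolding s_def[symmetric] by auto
    then have "j \<le> l" using l \<open>l \<le> q\<close> \<open>a j < a l\<close> unfolding C_def by auto
    then have "j < l" using l j by (auto simp: le_less)
    then have "anc j l" using anc_interval[of s l j] A_anc[of s l] l s j by auto
    then show False using decreasingD[OF a] \<open>a j < a l\<close> by fastforce
  qed
  have "\<not> anc s j" using A_up s j by blast
  moreover have "count_ge P c k x < count_ge P a k x"
    if "s \<le> k" "k < j" "a j < x" "x \<le> a s" for k x
  proof (rule strict[of s])
    \<comment> \<open>Such an \<open>l\<close> would be a target before \<open>j\<close>, as
      \<open>x \<le> a s \<le> a i\<close>.\<close>
    fix l assume "l \<in> P" "i < l" "l \<le> k" "l \<notin> A" "c q \<le> a l" "a l < x"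
    moreover have "a s \<le> a i" using monoA(1)[of i s] s iA A_ge by auto
    ultimately show False using j_least[of l] that unfolding target_def by auto
  qed (use s cs that in auto)
  ultimately show ?thesis using s j A_P by blast
qed

text \<open>The exchange costs one unit, exactly on the rectangle where the strict inequality leaves
  room for it.\<close>

lemma ex_min_disorder:
  assumes "decreasing a" "decreasing c"
    and "\<And>k x. count_ge P c k x \<le> count_ge P a k x"
    and "\<And>x. count_ge P a m x = count_ge P c m x"
    and "\<And>l. l \<in> P \<Longrightarrow> l \<le> m"
    and "\<exists>l\<in>P. a l \<noteq> c l"
  shows "\<exists>i j. min_disorder a i j \<and>
    (\<forall>k x. count_ge P c k x \<le> count_ge P (swap_entries i j a) k x)"
proof -
  obtain i j where "min_disorder a i j" and
    gap: "\<And>k x. i \<le> k \<Longrightarrow> k < j \<Longrightarrow> a j < x \<Longrightarrow> x \<le> a i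
      \<Longrightarrow> count_ge P c k x < count_ge P a k x"
  proof -
    obtain i j where "i \<in> P" "j \<in> P" "i < j" "\<not> anc i j" "a j < a i"
      and "\<forall>k x. i \<le> k \<and> k < j \<and> a j < x \<and> x \<le> a i
        \<longrightarrow> count_ge P c k x < count_ge P a k x"
      using ex_disorder[OF assms] by blast
    then show ?thesis
      using min_disorder_from_disorder[OF assms(1), of i j c] that by blast
  qed
  then have "i \<in> P" "j \<in> P" "i < j" "a j < a i" unfolding min_disorder_def by auto
  have "count_ge P c k x \<le> count_ge P (swap_entries i j a) k x" for k x
    using count_ge_swap_entries[OF finite_P \<open>i \<in> P\<close> \<open>j \<in> P\<close> \<open>i < j\<close> \<open>a j < a i\<close>, of k x]
      gap[of k x] assms(3)[of k x] by (auto simp: of_bool_def split: if_splits)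
  with \<open>min_disorder a i j\<close> show ?thesis by blast
qed

end

section \<open>Exchanges and the Bruhat order\<close>

lemma swap_entries_rearrangements:
  assumes "d \<in> rearrangements m lam" "i \<in> {1..m}" "j \<in> {1..m}"
  shows "swap_entries i j d \<in> rearrangements m lam"
proof -
  let ?t = "Transposition.transpose i j"
  have "?t ` {1..<Suc m} = {1..<Suc m}"
    using assms by (intro transpose_image_eq) auto
  then have "image_mset ?t (mset [1..<Suc m]) = mset [1..<Suc m]"
    by (simp only: mset_upt image_mset_mset_set[OF inj_on_transpose])
  then have "mset (map (d \<circ> ?t) [1..<Suc m]) = mset (map d [1..<Suc m])"
    by (simp only: mset_map flip: multiset.map_comp)
  moreover have "swap_entries i j d \<in> compositions m"
    using assms unfolding compositions_def rearrangements_def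
    by (auto simp: swap_entries_apply)
  ultimately show ?thesis
    using assms(1) unfolding rearrangements_def swap_entries_def by auto
qed

text \<open>Each generating exchange lowers counts only at some \<open>k < j\<close>; since
  \<open>j \<le> m\<close>, the counts at \<open>m\<close> are unchanged.\<close>

lemma bruhat_order_count_ge:
  assumes "(a, c) \<in> bruhat_order m lam"
  shows "(\<forall>k x. count_ge {1..m} c k x \<le> count_ge {1..m} a k x)
    \<and> (\<forall>x. count_ge {1..m} a m x = count_ge {1..m} c m x)"
proof -
  have swap: "(\<forall>k x. count_ge {1..m} (swap_entries i j b) k x \<le> count_ge {1..m} b k x)
      \<and> (\<forall>x. count_ge {1..m} b m x = count_ge {1..m} (swap_entries i j b) m x)"
    if "i \<in> {1..m}" "j \<in> {1..m}" "i < j" "b j < b i" for b i j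
  proof -
    note * = count_ge_swap_entries[OF finite_atLeastAtMost that]
    show ?thesis using *[symmetric] that by auto
  qed
  consider "a = c" | "(a, c) \<in> {(a, swap_entries i j a) | a i j.
      a \<in> rearrangements m lam \<and> i \<in> {1..m} \<and> j \<in> {1..m} \<and> i < j \<and> a i > a j}\<^sup>+"
    using assms unfolding bruhat_order_def generated_order_def by auto
  then show ?thesis
  proof cases
    case 2
    then show ?thesis
    proof (induction rule: trancl_induct)
      case (base y)
      then show ?case using swap by blast
    next
      case (step y z)
      then obtain i j where "z = swap_entries i j y" "i \<in> {1..m}" "j \<in> {1..m}" "i < j" "y j < y i"
        by blast
      with swap[of i j y] have "count_ge {1..m} z k x \<le> count_ge {1..m} y k x"
        "count_ge {1..m} y m x = count_ge {1..m} z m x" for k x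
        by blast+
      with step.IH show ?case by (metis le_trans)
    qed
  qed auto
qed

text \<open>A termination measure: the larger entry moves to a later position, where the weight
  \<open>m - l\<close> is smaller.\<close>

lemma sum_weighted_swap_entries_less:
  fixes d :: "nat \<Rightarrow> nat"
  assumes "i \<in> {1..m}" "j \<in> {1..m}" "i < j" "d j < d i"
  shows "(\<Sum>l=1..m. (m - l) * swap_entries i j d l) < (\<Sum>l=1..m. (m - l) * d l)"
proof -
  let ?R = "{1..m} - {i} - {j}"
  have split: "(\<Sum>l=1..m. f l) = f i + (f j + sum f ?R)" for f :: "nat \<Rightarrow> nat"
    using sum.remove[of "{1..m}" i f] sum.remove[of "{1..m} - {i}" j f] assms by simp
  have rest: "(\<Sum>l\<in>?R. (m - l) * swap_entries i j d l) = (\<Sum>l\<in>?R. (m - l) * d l)"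
    by (intro sum.cong) (auto simp: swap_entries_apply)
  obtain u where u: "m - i = (m - j) + u" "u > 0"
    using assms by (intro that[of "j - i"]) auto
  have "u * d j < u * d i" using u assms by simp
  then have "(m - i) * d j + (m - j) * d i < (m - i) * d i + (m - j) * d j"
    unfolding u by (simp add: algebra_simps)
  moreover have "swap_entries i j d i = d j" "swap_entries i j d j = d i"
    by (auto simp: swap_entries_apply)
  ultimately show ?thesis
    unfolding split[of "\<lambda>l. (m - l) * swap_entries i j d l"] split[of "\<lambda>l. (m - l) * d l"] rest
    by simp
qed

section \<open>From arborescent posets to forests\<close>

text \<open>Since \<open>v\<close> reverses the order, ancestors are the strictly smaller elements,
  the roots are the minimal ones, and \<open>above r s\<close> is the subtree at
  \<open>s\<close>.\<close>

definition position_anc :: "'s set \<Rightarrow> 's rel \<Rightarrow> ('s \<Rightarrow> nat) \<Rightarrow> nat \<Rightarrow> nat \<Rightarrow> bool" where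
  "position_anc S r v i l \<longleftrightarrow>
     i \<in> v ` S \<and> l \<in> v ` S \<and> (inv_into S v l, inv_into S v i) \<in> r - Id"

locale anti_linearized_poset =
  fixes m :: nat and S :: "'s set" and r :: "'s rel" and v :: "'s \<Rightarrow> nat"
  assumes arb: "arborescent_poset m S r v"
begin

lemma inj_v: "inj_on v S" and v_image: "v ` S \<subseteq> {1..m}"
  and r_order: "partial_order_on S r"
  and v_less: "s \<in> S \<Longrightarrow> t \<in> S \<Longrightarrow> (t, s) \<in> r - Id \<Longrightarrow> v s < v t"
  using arb unfolding arborescent_poset_def by blast+

lemma position_anc_v:
  "s \<in> S \<Longrightarrow> t \<in> S \<Longrightarrow> position_anc S r v (v s) (v t) \<longleftrightarrow> (t, s) \<in> r - Id"
  unfolding position_anc_def using inj_v by simp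

sublocale forest: postorder_forest "v ` S" "position_anc S r v"
proof
  show "finite (v ` S)" using arb unfolding arborescent_poset_def by blast
  show in_image: "i \<in> v ` S \<and> l \<in> v ` S" if "position_anc S r v i l" for i l
    using that unfolding position_anc_def by blast
  show "i < l" if "position_anc S r v i l" for i l
    using that v_less position_anc_v in_image by blast
  have tr: "trans r" and as: "antisym r"
    using r_order unfolding partial_order_on_def preorder_on_def by auto
  show "position_anc S r v i k" if "position_anc S r v i l" "position_anc S r v l k" for i l k
    using that tr as unfolding position_anc_def by (auto dest: transD antisymD)
  show "position_anc S r v j l"
    if il: "position_anc S r v i l" and j: "j \<in> v ` S" and "i < j" "j < l" for i l j
  proof -
    obtain s t u where "i = v s" "l = v t" "j = v u" "s \<in> S" "t \<in> S" "u \<in> S"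
      using il j unfolding position_anc_def by blast
    \<comment> \<open>Consistency enters here: the subtree at \<open>t\<close> occupies an interval
      of positions, which contains those of \<open>s\<close> and \<open>t\<close> and so also that
      of \<open>u\<close>.\<close>
    obtain x y where ab: "above r t = {w \<in> S. v w \<in> {x..y}}"
      using arb \<open>t \<in> S\<close> unfolding arborescent_poset_def by blast
    have "(t, t) \<in> r"
      using r_order \<open>t \<in> S\<close> unfolding partial_order_on_def preorder_on_def by (auto dest: refl_onD)
    moreover have "(t, s) \<in> r" using il position_anc_v \<open>i = v s\<close> \<open>l = v t\<close> \<open>s \<in> S\<close> \<open>t \<in> S\<close> by auto
    ultimately have "s \<in> above r t" "t \<in> above r t" unfolding above_def by auto
    then have "u \<in> above r t"
      unfolding ab using \<open>i < j\<close> \<open>j < l\<close> \<open>i = v s\<close> \<open>l = v t\<close> \<open>j = v u\<close> \<open>u \<in> S\<close> by auto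
    then have "(t, u) \<in> r - Id" using \<open>j < l\<close> \<open>l = v t\<close> \<open>j = v u\<close> unfolding above_def by auto
    then show ?thesis using position_anc_v \<open>l = v t\<close> \<open>j = v u\<close> \<open>t \<in> S\<close> \<open>u \<in> S\<close> by simp
  qed
qed

text \<open>Both argument orders occur in \<open>minimal_disorder\<close>, where \<open>l\<close> is
  compared with the earlier \<open>i\<close> and with the later \<open>j\<close>.\<close>

lemma incomparable_iff:
  assumes "i \<in> v ` S" "j \<in> v ` S" "i < j"
  shows "incomparable r (inv_into S v i) (inv_into S v j) \<longleftrightarrow> \<not> position_anc S r v i j"
    "incomparable r (inv_into S v j) (inv_into S v i) \<longleftrightarrow> \<not> position_anc S r v i j"
proof -
  have "inv_into S v i \<noteq> inv_into S v j" using assms by (metis f_inv_into_f nat_neq_iff)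
  moreover have "\<not> position_anc S r v j i" using assms forest.anc_less[of j i] by auto
  ultimately show "incomparable r (inv_into S v i) (inv_into S v j) \<longleftrightarrow> \<not> position_anc S r v i j"
    "incomparable r (inv_into S v j) (inv_into S v i) \<longleftrightarrow> \<not> position_anc S r v i j"
    using assms unfolding incomparable_def position_anc_def by auto
qed

lemma minimal_disorder_iff: "minimal_disorder S r v d i j \<longleftrightarrow> forest.min_disorder d i j"
proof (cases "i \<in> v ` S \<and> j \<in> v ` S \<and> i < j")
  case True
  have "(inv_into S v l, inv_into S v i) \<in> r - Id \<longleftrightarrow> position_anc S r v i l"
    "(inv_into S v j, inv_into S v l) \<in> r - Id \<longleftrightarrow> position_anc S r v l j"
    if "l \<in> v ` S" for l
    using that True unfolding position_anc_def by auto
  then show ?thesis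
    using True unfolding minimal_disorder_def forest.min_disorder_def
    by (simp add: incomparable_iff cong: ball_cong conj_cong imp_cong)
next
  case False
  then show ?thesis unfolding minimal_disorder_def forest.min_disorder_def by auto
qed

lemma S_dominant_iff:
  "S_dominant m S r v d \<longleftrightarrow>
     d \<in> compositions m \<and> (\<forall>l\<in>{1..m} - v ` S. d l = 0) \<and> forest.decreasing d"
proof -
  have "(\<forall>s\<in>S. \<forall>t\<in>S. (t, s) \<in> r - Id \<longrightarrow> d (v s) \<ge> d (v t)) \<longleftrightarrow> forest.decreasing d"
    unfolding forest.decreasing_def
    using position_anc_v forest.anc_in by blast
  then show ?thesis unfolding S_dominant_def by blast
qed

lemma swap_entries_dominant_rearrangements:
  assumes a: "a \<in> dominant_rearrangements m S r v lam" and md: "minimal_disorder S r v a i j"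
  shows "swap_entries i j a \<in> dominant_rearrangements m S r v lam"
proof -
  have ij: "i \<in> v ` S" "j \<in> v ` S" using md unfolding minimal_disorder_def by auto
  then have "swap_entries i j a \<in> rearrangements m lam"
    using a v_image unfolding dominant_rearrangements_def
    by (intro swap_entries_rearrangements) auto
  moreover have "forest.decreasing (swap_entries i j a)"
    using a md forest.decreasing_swap_entries
    unfolding dominant_rearrangements_def S_dominant_iff minimal_disorder_iff by blast
  ultimately show ?thesis
    using a ij unfolding dominant_rearrangements_def S_dominant_iff rearrangements_def
    by (auto simp: swap_entries_apply)
qed

text \<open>Entries outside the image of \<open>v\<close> vanish, so only the threshold
  \<open>0\<close> sees them, and there the count does not depend on \<open>d\<close>. Thus
  inequalities between counts over \<open>{1..m}\<close> carry over to the forest.\<close>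

lemma count_ge_dominant:
  assumes "S_dominant m S r v d"
  shows "count_ge (v ` S) d k x
    = (if x = 0 then card {l \<in> v ` S. l \<le> k} else count_ge {1..m} d k x)"
proof (cases "x = 0")
  case False
  then have "{l \<in> v ` S. l \<le> k \<and> x \<le> d l} = {l \<in> {1..m}. l \<le> k \<and> x \<le> d l}"
    using assms v_image unfolding S_dominant_def by fastforce
  then show ?thesis using False unfolding count_ge_def by simp
qed (simp add: count_ge_def)

section \<open>Chains of minimal disorders\<close>

text \<open>Exchanging a disorder from \<open>ex_min_disorder\<close> keeps all hypotheses on
  \<open>a\<close> and lowers the weighted sum, so induction on that sum builds the chain to
  \<open>c\<close>.\<close>

lemma count_ge_imp_generated:
  assumes "a \<in> dominant_rearrangements m S r v lam" "c \<in> dominant_rearrangements m S r v lam"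
    and "\<And>k x. count_ge (v ` S) c k x \<le> count_ge (v ` S) a k x"
    and "\<And>x. count_ge (v ` S) a m x = count_ge (v ` S) c m x"
  shows "(a, c) \<in> generated_order (dominant_rearrangements m S r v lam)
      {(a, swap_entries i j a) | a i j.
         a \<in> dominant_rearrangements m S r v lam \<and> minimal_disorder S r v a i j}"
    (is "_ \<in> generated_order ?D ?R")
  using assms
proof (induction "\<Sum>l=1..m. (m - l) * a l" arbitrary: a rule: less_induct)
  case less
  show ?case
  proof (cases "\<exists>l\<in>v ` S. a l \<noteq> c l")
    case False
    have "a l = c l" for l
      using less.prems(1,2) False
      unfolding dominant_rearrangements_def S_dominant_def compositions_def
      by (cases "l \<in> {1..m} - v ` S"; cases "l \<in> v ` S") auto
    then have "a = c" by blast
    then show ?thesis using less.prems unfolding generated_order_def by auto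
  next
    case True
    have dec: "forest.decreasing a" "forest.decreasing c"
      using less.prems unfolding dominant_rearrangements_def S_dominant_iff by auto
    obtain i j where md: "forest.min_disorder a i j" and
      dom: "\<And>k x. count_ge (v ` S) c k x \<le> count_ge (v ` S) (swap_entries i j a) k x"
      using forest.ex_min_disorder[OF dec less.prems(3,4) _ True] v_image by force
    let ?b = "swap_entries i j a"
    have ij: "i \<in> v ` S" "j \<in> v ` S" "i < j" "a j < a i"
      using md unfolding forest.min_disorder_def by auto
    have ijm: "i \<in> {1..m}" "j \<in> {1..m}" using ij v_image by auto
    have b: "?b \<in> ?D"
      using swap_entries_dominant_rearrangements less.prems(1) md minimal_disorder_iff by blast
    have "count_ge (v ` S) ?b m x = count_ge (v ` S) c m x" for x
      using count_ge_swap_entries[OF forest.finite_P ij, of m x] less.prems(4)[of x] ijm by auto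
    then have "(?b, c) \<in> generated_order ?D ?R"
      using less.hyps[OF sum_weighted_swap_entries_less[OF ijm ij(3,4)] b less.prems(2) dom] by blast
    moreover have "(a, ?b) \<in> ?R" using less.prems(1) md minimal_disorder_iff by blast
    ultimately show ?thesis
      unfolding generated_order_def by (auto intro: trancl_into_trancl2)
  qed
qed

text \<open>A Bruhat chain between dominant compositions may pass through others that are not
  dominant. Hence only its effect on the counts is kept, and a new chain is built from them.
  Conversely, minimal disorders are Bruhat exchanges that preserve dominance.\<close>

lemma Restr_bruhat_order:
  "Restr (bruhat_order m lam) (dominant_rearrangements m S r v lam) =
    generated_order (dominant_rearrangements m S r v lam)
      {(a, swap_entries i j a) | a i j.
         a \<in> dominant_rearrangements m S r v lam \<and> minimal_disorder S r v a i j}"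
  (is "Restr ?B ?D = generated_order ?D ?R")
proof
  show "Restr ?B ?D \<subseteq> generated_order ?D ?R"
  proof clarify
    fix a c assume ac: "(a, c) \<in> ?B" and a: "a \<in> ?D" and c: "c \<in> ?D"
    have "S_dominant m S r v a" "S_dominant m S r v c"
      using a c unfolding dominant_rearrangements_def by auto
    then show "(a, c) \<in> generated_order ?D ?R"
      using bruhat_order_count_ge[OF ac]
      by (intro count_ge_imp_generated[OF a c]) (auto simp: count_ge_dominant)
  qed
next
  have "?R \<subseteq> ?D \<times> ?D" using swap_entries_dominant_rearrangements by blast
  then have "?R\<^sup>+ \<subseteq> ?D \<times> ?D" by (rule trancl_subset_Sigma)
  moreover have "?R \<subseteq> {(a, swap_entries i j a) | a i j.
      a \<in> rearrangements m lam \<and> i \<in> {1..m} \<and> j \<in> {1..m} \<and> i < j \<and> a i > a j}"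
    using v_image unfolding dominant_rearrangements_def minimal_disorder_def by blast
  then have "?R\<^sup>+ \<subseteq> ?B"
    unfolding bruhat_order_def generated_order_def using trancl_mono_subset by blast
  moreover have "Id_on ?D \<subseteq> ?B"
    unfolding bruhat_order_def generated_order_def dominant_rearrangements_def by auto
  ultimately show "generated_order ?D ?R \<subseteq> Restr ?B ?D"
    unfolding generated_order_def by auto
qed

end

theorem theorem2p18:
  fixes m :: nat and S :: "'s set" and r :: "'s rel" and v :: "'s \<Rightarrow> nat" and lam :: "nat list"
  assumes "arborescent_poset m S r v"
    and "is_partition lam"
  shows "Restr (bruhat_order m lam) (dominant_rearrangements m S r v lam) =
    generated_order (dominant_rearrangements m S r v lam)
      {(a, swap_entries i j a) | a i j.
         a \<in> dominant_rearrangements m S r v lam \<and> minimal_disorder S r v a i j}"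
  by (rule anti_linearized_poset.Restr_bruhat_order[OF anti_linearized_poset.intro[OF assms(1)]])

end
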